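(* For every event-clock automaton $A=(Q,q_i,\Sigma,\delta,\alpha)$ with maximal constant $c_{\max}$: $L(RA(\exists,\mathrm{Reg}(C(\Sigma),c_{\max}),A))\subseteq\mathrm{untime}(L(A))$.
   Context: Event clocks over finite alphabet $\Sigma$: $C(\Sigma)=H(\Sigma)\cup P(\Sigma)$ with history clocks $\overleftarrow{x}_\sigma$ and prophecy clocks $\overrightarrow{x}_\sigma$. Valuations $v:C(\Sigma)\to\mathbb{R}_{\ge0}\cup\{\bot\}$. For $d\ge0$ (with $v(x)\ge d$ for prophecy $x$, $v(x)\ne\bot$), $v+d$ adds $d$ to history clocks and subtracts $d$ from prophecy clocks, $\bot\pm d=\bot$. $v[x:=c]$ changes only $x$. Initial valuation: all history clocks $\bot$; final: all prophecy clocks $\bot$. Clock constraints: Boolean combinations of $\mathsf{true}$ and $x\sim c$ ($c\in\mathbb{N}$, $\sim\in\{<,>,=\}$), $v\models x\sim c$ iff $v(x)\sim c$. ECA $A=(Q,q_i,\Sigma,\delta,\alpha)$: finite locations $Q$, $q_i\in Q$, finite $\delta\subseteq Q\times\Sigma\times\Phi(C(\Sigma))\times Q$, $\alpha\subseteq Q$; $c_{\max}$ = largest constant in its guards. $(q,v)\xrightarrow{t,\sigma}(q',v')$ iff there are $(q,\sigma,\psi,q')\in\delta$ and $\bar v$ with $\bar v[\overrightarrow{x}_\sigma:=0]=v+t$, $\bar v[\overleftarrow{x}_\sigma:=0]=v'$, $\bar v\models\psi$. Timed word $\theta=(\tau,w)$, $w=w_0\cdots w_{n-1}$, $\tau$ nondecreasing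 nonnegative; run: $(q_0,v_0),\dots,(q_n,v_n)$ with $q_0=q_i$, $v_0$ initial, $(q_k,v_k)\xrightarrow{t_k,w_k}(q_{k+1},v_{k+1})$, $t_0=\tau_0$, $t_k=\tau_k-\tau_{k-1}$; accepting iff $q_n\in\alpha$, $v_n$ final. $L(A)$ = timed words with an accepting run; $\mathrm{untime}(\tau,w)=w$ extended to sets. Regions: $\{v(x)\}=\lceil v(x)\rceil-v(x)$ for history $x$, $v(x)-\lfloor v(x)\rfloor$ for prophecy $x$. $v_1\cong v_2$ iff (C1) for all clocks $x$, $v_1(x)=\bot\iff v_2(x)=\bot$; (C2) for all $x$ either $v_1(x),v_2(x)>c_{\max}$ or $\lceil v_1(x)\rceil=\lceil v_2(x)\rceil$ and $\lfloor v_1(x)\rfloor=\lfloor v_2(x)\rfloor$; (C3) for all $x_1,x_2$ with $v_1(x_1),v_1(x_2)\le c_{\max}$: $\{v_1(x_1)\}\le\{v_1(x_2)\}$ iff $\{v_2(x_1)\}\le\{v_2(x_2)\}$. $\mathrm{Reg}(C(\Sigma),c_{\max})$ is the set of $\cong$-classes (regions); a region is initial (final) if all its valuations are initial (final). Existential region automaton $RA(\exists,\mathcal{R},A)$ for a set of regions $\mathcal{R}$: states $Q\times\mathcal{R}$; initial states $(q_i,r)$ with $r$ initial; accepting states $(q,r)$ with $q\in\alpha$, $r$ final; edge $((q_1,r_1),a,(q_2,r_2))$ iff there exist $v_1\in r_1$, $t\ge0$ and $v_2\in r_2$ with $(q_1,v_1)\xrightarrow{t,a}(q_2,v_2)$.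 Its language is the set of untimed words $w_0\cdots w_n$ labelling a path of edges from an initial to an accepting state. *)

theory Defs
  imports Complex_Main
begin

text \<open>The finite alphabet is a type of class \<open>finite\<close>; the clock set over it is then
  the whole type of clocks.\<close>

datatype 'a clock = Hist 'a | Proph 'a

text \<open>The value \<open>None\<close> encodes the undefined clock value; non-negativity of the defined values
  is imposed by membership in \<open>valuations\<close>.\<close>

type_synonym 'a valuation = "'a clock \<Rightarrow> real option"

definition valuations :: "'a valuation set" where
  "valuations = {v. \<forall>x d. v x = Some d \<longrightarrow> d \<ge> 0}"

definition initial_valuation :: "'a valuation \<Rightarrow> bool" where
  "initial_valuation v \<longleftrightarrow> (\<forall>s. v (Hist s) = None)"

definition final_valuation :: "'a valuation \<Rightarrow> bool" where
  "final_valuation v \<longleftrightarrow> (\<forall>s. v (Proph s) = None)"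

text \<open>Letting time pass is a partial operation: \<open>delay v t\<close> is only meaningful when
  \<open>can_delay v t\<close> holds.\<close>

definition can_delay :: "'a valuation \<Rightarrow> real \<Rightarrow> bool" where
  "can_delay v t \<longleftrightarrow> t \<ge> 0 \<and> (\<forall>s d. v (Proph s) = Some d \<longrightarrow> d \<ge> t)"

definition delay :: "'a valuation \<Rightarrow> real \<Rightarrow> 'a valuation" where
  "delay v t = (\<lambda>x. case x of
     Hist s \<Rightarrow> map_option (\<lambda>d. d + t) (v x)
   | Proph s \<Rightarrow> map_option (\<lambda>d. d - t) (v x))"

datatype comparison = Lt | Gt | Eq

fun compares :: "comparison \<Rightarrow> real \<Rightarrow> real \<Rightarrow> bool" where
  "compares Lt a b \<longleftrightarrow> a < b"
| "compares Gt a b \<longleftrightarrow> a > b"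
| "compares Eq a b \<longleftrightarrow> a = b"

datatype 'a guard =
    TT
  | Atom "'a clock" comparison nat
  | Neg "'a guard"
  | Conj "'a guard" "'a guard"
  | Disj "'a guard" "'a guard"

text \<open>An atomic comparison is false on an undefined clock, so its negation is true there.\<close>

fun sat :: "'a valuation \<Rightarrow> 'a guard \<Rightarrow> bool" where
  "sat v TT \<longleftrightarrow> True"
| "sat v (Atom x r c) \<longleftrightarrow> (case v x of None \<Rightarrow> False | Some d \<Rightarrow> compares r d (real c))"
| "sat v (Neg g) \<longleftrightarrow> \<not> sat v g"
| "sat v (Conj g h) \<longleftrightarrow> sat v g \<and> sat v h"
| "sat v (Disj g h) \<longleftrightarrow> sat v g \<or> sat v h"

fun guard_constants :: "'a guard \<Rightarrow> nat set" where
  "guard_constants TT = {}"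
| "guard_constants (Atom x r c) = {c}"
| "guard_constants (Neg g) = guard_constants g"
| "guard_constants (Conj g h) = guard_constants g \<union> guard_constants h"
| "guard_constants (Disj g h) = guard_constants g \<union> guard_constants h"

record ('q, 'a) eca =
  locations :: "'q set"
  start :: 'q
  transitions :: "('q \<times> 'a \<times> 'a guard \<times> 'q) set"
  accept_locs :: "'q set"

definition wf_eca :: "('q, 'a) eca \<Rightarrow> bool" where
  "wf_eca A \<longleftrightarrow>
     finite (locations A) \<and> start A \<in> locations A \<and>
     finite (transitions A) \<and>
     transitions A \<subseteq> locations A \<times> UNIV \<times> UNIV \<times> locations A \<and>
     accept_locs A \<subseteq> locations A"

text \<open>Automata whose guards mention no constant get the value 0.\<close>

definition cmax :: "('q, 'a) eca \<Rightarrow> nat" where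
  "cmax A = Max (insert 0 (\<Union>(q, s, g, q') \<in> transitions A. guard_constants g))"

definition step ::
  "('q, 'a) eca \<Rightarrow> 'q \<times> 'a valuation \<Rightarrow> real \<Rightarrow> 'a \<Rightarrow> 'q \<times> 'a valuation \<Rightarrow> bool" where
  "step A c t s c' \<longleftrightarrow>
     (case c of (q, v) \<Rightarrow> case c' of (q', v') \<Rightarrow>
       v \<in> valuations \<and> v' \<in> valuations \<and> can_delay v t \<and>
       (\<exists>g u. (q, s, g, q') \<in> transitions A \<and> u \<in> valuations \<and>
              u(Proph s := Some 0) = delay v t \<and>
              u(Hist s := Some 0) = v' \<and>
              sat u g))"

type_synonym 'a timed_word = "real list \<times> 'a list"

definition timed_words :: "'a timed_word set" where
  "timed_words =
     {(\<tau>, w). length \<tau> = length w \<and> sorted \<tau> \<and> (\<forall>t \<in> set \<tau>. t \<ge> 0)}"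

definition accepting_run ::
  "('q, 'a) eca \<Rightarrow> 'a timed_word \<Rightarrow> (nat \<Rightarrow> 'q \<times> 'a valuation) \<Rightarrow> bool" where
  "accepting_run A \<theta> \<rho> \<longleftrightarrow>
     (case \<theta> of (\<tau>, w) \<Rightarrow>
       fst (\<rho> 0) = start A \<and> snd (\<rho> 0) \<in> valuations \<and> initial_valuation (snd (\<rho> 0)) \<and>
       (\<forall>k < length w.
          step A (\<rho> k) (if k = 0 then \<tau> ! 0 else \<tau> ! k - \<tau> ! (k - 1)) (w ! k) (\<rho> (Suc k))) \<and>
       fst (\<rho> (length w)) \<in> accept_locs A \<and> final_valuation (snd (\<rho> (length w))))"

definition lang :: "('q, 'a) eca \<Rightarrow> 'a timed_word set" where
  "lang A = {\<theta> \<in> timed_words. \<exists>\<rho>. accepting_run A \<theta> \<rho>}"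

definition untime :: "'a timed_word \<Rightarrow> 'a list" where
  "untime \<theta> = snd \<theta>"

text \<open>The distance to the next integer boundary as time passes; it depends on the
  direction in which the clock evolves.\<close>

fun clock_frac :: "'a clock \<Rightarrow> real \<Rightarrow> real" where
  "clock_frac (Hist s) d = of_int \<lceil>d\<rceil> - d"
| "clock_frac (Proph s) d = d - of_int \<lfloor>d\<rfloor>"

text \<open>Undefined clocks are compared by the first conjunct only: an undefined value is
  neither below nor above \<open>c\<close>.\<close>

definition region_equiv :: "nat \<Rightarrow> 'a valuation \<Rightarrow> 'a valuation \<Rightarrow> bool" where
  "region_equiv c v1 v2 \<longleftrightarrow>
     (\<forall>x. v1 x = None \<longleftrightarrow> v2 x = None) \<and>
     (\<forall>x a b. v1 x = Some a \<and> v2 x = Some b \<longrightarrow>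
        (a > real c \<and> b > real c) \<or> (\<lceil>a\<rceil> = \<lceil>b\<rceil> \<and> \<lfloor>a\<rfloor> = \<lfloor>b\<rfloor>)) \<and>
     (\<forall>x y a1 a2 b1 b2.
        v1 x = Some a1 \<and> v1 y = Some a2 \<and> v2 x = Some b1 \<and> v2 y = Some b2 \<and>
        a1 \<le> real c \<and> a2 \<le> real c \<longrightarrow>
        (clock_frac x a1 \<le> clock_frac y a2 \<longleftrightarrow> clock_frac x b1 \<le> clock_frac y b2))"

definition Reg :: "nat \<Rightarrow> 'a valuation set set" where
  "Reg c = valuations // {(v1, v2). v1 \<in> valuations \<and> v2 \<in> valuations \<and> region_equiv c v1 v2}"

definition initial_region :: "'a valuation set \<Rightarrow> bool" where
  "initial_region r \<longleftrightarrow> (\<forall>v \<in> r. initial_valuation v)"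

definition final_region :: "'a valuation set \<Rightarrow> bool" where
  "final_region r \<longleftrightarrow> (\<forall>v \<in> r. final_valuation v)"

record ('s, 'a) automaton =
  states :: "'s set"
  initials :: "'s set"
  accepting :: "'s set"
  edges :: "('s \<times> 'a \<times> 's) set"

definition automaton_lang :: "('s, 'a) automaton \<Rightarrow> 'a list set" where
  "automaton_lang B =
     {w. \<exists>p. p 0 \<in> initials B \<and> p (length w) \<in> accepting B \<and>
             (\<forall>k < length w. (p k, w ! k, p (Suc k)) \<in> edges B)}"

definition RA_exists ::
  "'a valuation set set \<Rightarrow> ('q, 'a) eca \<Rightarrow> ('q \<times> 'a valuation set, 'a) automaton" where
  "RA_exists R A =
     \<lparr> states = locations A \<times> R,
       initials = {(q, r). q = start A \<and> r \<in> R \<and> initial_region r},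
       accepting = {(q, r). q \<in> accept_locs A \<and> r \<in> R \<and> final_region r},
       edges = {((q1, r1), a, (q2, r2)).
                  q1 \<in> locations A \<and> q2 \<in> locations A \<and> r1 \<in> R \<and> r2 \<in> R \<and>
                  (\<exists>v1 \<in> r1. \<exists>t \<ge> 0. \<exists>v2 \<in> r2. step A (q1, v1) t a (q2, v2))} \<rparr>"

end

theory Submission
  imports Defs
begin

text \<open>
  A region path is realised backwards from its end. Prophecy clocks above \<open>c\<close> are not controlled by
  the region, so a valuation \<open>u\<close> of the first region is only matched up to changing those clocks
  (\<open>far_variant\<close>); such a change propagates to earlier valuations without leaving their regions.
  For a single step, place a history clock of value \<open>d\<close> at \<open>-d\<close> and a prophecy clock of value \<open>d\<close> at
  \<open>d\<close> on the real line: letting time pass is a translation, the region records integer parts and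
  the order of fractional parts, and by density of the reals a configuration of points can be
  extended compatibly by further points. Before an \<open>a\<close>-step the prophecy clock of \<open>a\<close> equals the
  delay, so the delay is itself one of these points.
\<close>

section \<open>Configurations of points on the line\<close>

text \<open>Region equivalence without the bound \<open>c\<close> and without clock directions:
  every point of \<open>I\<close> is compared exactly. Integrality of the points takes the place of
  the ceilings.\<close>

definition frac_similar :: "'i set \<Rightarrow> ('i \<Rightarrow> real) \<Rightarrow> ('i \<Rightarrow> real) \<Rightarrow> bool" where
  "frac_similar I e f \<longleftrightarrow>
     (\<forall>i\<in>I. \<lfloor>e i\<rfloor> = \<lfloor>f i\<rfloor> \<and> (frac (e i) = 0 \<longleftrightarrow> frac (f i) = 0)) \<and>
     (\<forall>i\<in>I. \<forall>j\<in>I. frac (e i) \<le> frac (e j) \<longleftrightarrow> frac (f i) \<le> frac (f j))"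

lemma frac_similar_mono: "frac_similar J e f \<Longrightarrow> I \<subseteq> J \<Longrightarrow> frac_similar I e f"
  unfolding frac_similar_def by blast

lemma frac_similar_cong:
  assumes "\<And>i. i \<in> I \<Longrightarrow> e i = e' i" "\<And>i. i \<in> I \<Longrightarrow> f i = f' i"
  shows "frac_similar I e f \<longleftrightarrow> frac_similar I e' f'"
  using assms unfolding frac_similar_def by simp

text \<open>The constraints on \<open>y\<close> only say where it lies in the finite ordered set of
  values \<open>frac (f i)\<close>. Either this position is forced, at \<open>0\<close> or at an
  existing value, or it is an open gap, which density fills.\<close>

lemma compatible_frac_exists:
  fixes e f :: "'i \<Rightarrow> real"
  assumes "finite I" and sim: "frac_similar I e f" and x: "0 \<le> x" "x < 1"
  shows "\<exists>y. 0 \<le> y \<and> y < 1 \<and> (x = 0 \<longleftrightarrow> y = 0) \<and>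
    (\<forall>i\<in>I. (frac (e i) \<le> x \<longleftrightarrow> frac (f i) \<le> y) \<and> (x \<le> frac (e i) \<longleftrightarrow> y \<le> frac (f i)))"
proof -
  have zero: "frac (e i) = 0 \<longleftrightarrow> frac (f i) = 0" if "i \<in> I" for i
    using sim that unfolding frac_similar_def by blast
  have ord: "frac (e i) \<le> frac (e j) \<longleftrightarrow> frac (f i) \<le> frac (f j)" if "i \<in> I" "j \<in> I" for i j
    using sim that unfolding frac_similar_def by blast
  consider "x = 0" | i where "i \<in> I" "frac (e i) = x" | "x > 0" "\<forall>i\<in>I. frac (e i) \<noteq> x"
    using x by fastforce
  then show ?thesis
  proof cases
    case 1
    have "(frac (e i) \<le> x \<longleftrightarrow> frac (f i) \<le> 0) \<and> (x \<le> frac (e i) \<longleftrightarrow> 0 \<le> frac (f i))"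
      if "i \<in> I" for i
      using zero[OF that] frac_ge_0[of "e i"] frac_ge_0[of "f i"] 1 by linarith
    with 1 show ?thesis by (intro exI[of _ 0]) auto
  next
    case (2 i)
    then show ?thesis
      using zero ord frac_ge_0[of "f i"] frac_lt_1[of "f i"] by (intro exI[of _ "frac (f i)"]) auto
  next
    case 3
    \<comment> \<open>\<open>L\<close> and \<open>U\<close> bound the gap from below and above. The
      added endpoints \<open>0\<close> and \<open>1\<close> make both sets nonempty and force
      \<open>y\<close> strictly inside the unit interval.\<close>
    define L where "L = insert 0 ((\<lambda>i. frac (f i)) ` {i\<in>I. frac (e i) < x})"
    define U where "U = insert 1 ((\<lambda>i. frac (f i)) ` {i\<in>I. frac (e i) > x})"
    have fin: "finite L" "finite U" "L \<noteq> {}" "U \<noteq> {}"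
      using \<open>finite I\<close> by (auto simp: L_def U_def)
    have "l < u" if l: "l \<in> L" and u: "u \<in> U" for l u
    proof -
      \<comment> \<open>Against the endpoint \<open>0\<close> the order relation says nothing; here
        the agreement on integrality is used.\<close>
      have *: "0 < frac (f i)" if "i \<in> I" "x < frac (e i)" for i
        using zero[OF that(1)] that 3(1) frac_ge_0[of "f i"] by linarith
      have **: "frac (f i) < frac (f j)" if "i \<in> I" "j \<in> I" "frac (e i) < x" "x < frac (e j)" for i j
        using ord[OF that(2,1)] that(3,4) by linarith
      show ?thesis using l u unfolding L_def U_def
        by (auto intro: * ** simp: frac_lt_1)
    qed
    then have "Max L < Min U" using fin by simp
    then obtain y where y: "Max L < y" "y < Min U" using dense by blast
    have Ly: "\<And>l. l \<in> L \<Longrightarrow> l < y" and Uy: "\<And>u. u \<in> U \<Longrightarrow> y < u"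
      using y fin by auto
    have "0 < y" "y < 1" using Ly[of 0] Uy[of 1] by (auto simp: L_def U_def)
    moreover have "(frac (e i) \<le> x \<longleftrightarrow> frac (f i) \<le> y) \<and> (x \<le> frac (e i) \<longleftrightarrow> y \<le> frac (f i))"
      if "i \<in> I" for i
    proof (cases "frac (e i) < x")
      case True
      then have "frac (f i) < y" using Ly that by (auto simp: L_def)
      with True show ?thesis by auto
    next
      case False
      then have "x < frac (e i)" using 3(2) that by fastforce
      then have "y < frac (f i)" using Uy that by (auto simp: U_def)
      with \<open>x < frac (e i)\<close> show ?thesis by auto
    qed
    ultimately show ?thesis using 3(1) by (intro exI[of _ y]) auto
  qed
qed

text \<open>A new point interacts with the others only through its fractional part, so its integer
  part can be copied from \<open>e k\<close>.\<close>

lemma frac_similar_insert: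
  assumes "finite I" and sim: "frac_similar I e f" and k: "k \<notin> I"
  shows "\<exists>y. frac_similar (insert k I) e (f(k := y))"
proof -
  obtain g where "0 \<le> g \<and> g < 1 \<and> (frac (e k) = 0 \<longleftrightarrow> g = 0) \<and>
    (\<forall>i\<in>I. (frac (e i) \<le> frac (e k) \<longleftrightarrow> frac (f i) \<le> g) \<and>
      (frac (e k) \<le> frac (e i) \<longleftrightarrow> g \<le> frac (f i)))"
    using compatible_frac_exists[OF assms(1) sim frac_ge_0 frac_lt_1, of "e k"] ..
  then have g: "0 \<le> g" "g < 1" "frac (e k) = 0 \<longleftrightarrow> g = 0"
    "\<And>i. i \<in> I \<Longrightarrow> frac (e i) \<le> frac (e k) \<longleftrightarrow> frac (f i) \<le> g"
    "\<And>i. i \<in> I \<Longrightarrow> frac (e k) \<le> frac (e i) \<longleftrightarrow> g \<le> frac (f i)"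
    by auto
  define y where "y = of_int \<lfloor>e k\<rfloor> + g"
  have fl: "\<lfloor>y\<rfloor> = \<lfloor>e k\<rfloor>" using g by (simp add: y_def floor_unique)
  then have fr: "frac y = g" by (simp add: frac_def) (simp add: y_def)
  have "frac_similar (insert k I) e (f(k := y))"
    using sim k g fl fr unfolding frac_similar_def by auto
  then show ?thesis ..
qed

text \<open>Points are added one at a time. Values on \<open>I\<close> are kept, so clock values
  already prescribed survive the extension.\<close>

lemma frac_similar_extend:
  assumes "finite J" "finite I" "frac_similar I e f"
  shows "\<exists>f'. frac_similar (I \<union> J) e f' \<and> (\<forall>i\<in>I. f' i = f i)"
  using assms(1)
proof induction
  case empty
  then show ?case using assms by auto
next
  case (insert k J)
  then obtain f' where f': "frac_similar (I \<union> J) e f'" "\<forall>i\<in>I. f' i = f i" by blast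
  show ?case
  proof (cases "k \<in> I \<union> J")
    case True
    then show ?thesis using f' by (intro exI[of _ f']) (simp add: insert_absorb)
  next
    case False
    then obtain y where "frac_similar (insert k (I \<union> J)) e (f'(k := y))"
      using frac_similar_insert[OF _ f'(1)] insert.hyps assms(2) by blast
    then have "frac_similar (I \<union> insert k J) e (f'(k := y))" by (simp only: Un_insert_right)
    moreover have "\<forall>i\<in>I. (f'(k := y)) i = f i" using f'(2) False by auto
    ultimately show ?thesis by blast
  qed
qed

text \<open>Subtracting \<open>t\<close> borrows a unit exactly when \<open>frac x < frac t\<close>.
  Integer parts and the order of fractional parts therefore decide how a difference behaves.\<close>

lemma
  fixes x t :: real
  shows floor_diff_frac: "\<lfloor>x - t\<rfloor> = (if frac t \<le> frac x then \<lfloor>x\<rfloor> - \<lfloor>t\<rfloor> else \<lfloor>x\<rfloor> - \<lfloor>t\<rfloor> - 1)" (is ?A)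
    and frac_diff: "frac (x - t) = (if frac t \<le> frac x then frac x - frac t else frac x - frac t + 1)"
proof -
  have *: "x - t = of_int \<lfloor>x\<rfloor> - of_int \<lfloor>t\<rfloor> + (frac x - frac t)" by (simp add: frac_def)
  have **: "0 \<le> frac x" "frac x < 1" "0 \<le> frac t" "frac t < 1"
    by (simp_all add: frac_lt_1)
  show ?A
  proof (cases "frac t \<le> frac x")
    case True
    with * ** have "of_int (\<lfloor>x\<rfloor> - \<lfloor>t\<rfloor>) \<le> x - t" "x - t < of_int (\<lfloor>x\<rfloor> - \<lfloor>t\<rfloor>) + 1"
      unfolding of_int_diff by linarith+
    then have "\<lfloor>x - t\<rfloor> = \<lfloor>x\<rfloor> - \<lfloor>t\<rfloor>" by (rule floor_unique)
    then show ?thesis using True by simp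
  next
    case False
    with * ** have "of_int (\<lfloor>x\<rfloor> - \<lfloor>t\<rfloor> - 1) \<le> x - t" "x - t < of_int (\<lfloor>x\<rfloor> - \<lfloor>t\<rfloor> - 1) + 1"
      unfolding of_int_diff of_int_1 by linarith+
    then have "\<lfloor>x - t\<rfloor> = \<lfloor>x\<rfloor> - \<lfloor>t\<rfloor> - 1" by (rule floor_unique)
    then show ?thesis using False by simp
  qed
  then show "frac (x - t) = (if frac t \<le> frac x then frac x - frac t else frac x - frac t + 1)"
    by (simp add: frac_def)
qed

text \<open>Because the shift is itself a point of the configuration, the subtraction borrows at the
  same indices on both sides. Afterwards the points that do not borrow precede those that do, and
  within each group the order is unchanged.\<close>

lemma frac_similar_translate:
  assumes sim: "frac_similar I e f" and k: "k \<in> I"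
  shows "frac_similar I (\<lambda>i. e i - e k) (\<lambda>i. f i - f k)"
proof -
  have ord: "frac (e i) \<le> frac (e j) \<longleftrightarrow> frac (f i) \<le> frac (f j)" if "i \<in> I" "j \<in> I" for i j
    using sim that unfolding frac_similar_def by blast
  have fl: "\<lfloor>e i\<rfloor> = \<lfloor>f i\<rfloor>" if "i \<in> I" for i
    using sim that unfolding frac_similar_def by blast
  have fl': "\<lfloor>e i - e k\<rfloor> = \<lfloor>f i - f k\<rfloor>" if "i \<in> I" for i
    unfolding floor_diff_frac using fl ord k that by simp
  \<comment> \<open>A difference is integral exactly when both fractional parts agree, which amounts
    to two order statements.\<close>
  have zero': "frac (e i - e k) = 0 \<longleftrightarrow> frac (f i - f k) = 0" if "i \<in> I" for i
    unfolding frac_diff using ord[OF that k] ord[OF k that]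
      frac_lt_1[of "e k"] frac_lt_1[of "f k"] frac_ge_0[of "e i"] frac_ge_0[of "f i"]
    by (smt (verit))
  have ord': "frac (e i - e k) \<le> frac (e j - e k) \<longleftrightarrow> frac (f i - f k) \<le> frac (f j - f k)"
    if ij: "i \<in> I" "j \<in> I" for i j
  proof -
    have "0 \<le> frac x \<and> frac x < 1" for x :: real by (simp add: frac_lt_1)
    from this[of "e i"] this[of "e j"] this[of "f i"] this[of "f j"] this[of "e k"] this[of "f k"]
      ord[OF ij] ord[OF k ij(1)] ord[OF k ij(2)]
    show ?thesis unfolding frac_diff by (smt (verit))
  qed
  show ?thesis unfolding frac_similar_def using fl' zero' ord' by blast
qed

text \<open>Zero has the least possible fractional part on both sides. This is the situation of a
  clock that has just been reset.\<close>

lemma frac_similar_insert_zero: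
  assumes "frac_similar I e f" "e k = 0" "f k = 0"
  shows "frac_similar (insert k I) e f"
proof -
  have "frac x \<le> 0 \<longleftrightarrow> frac x = 0" for x :: real using frac_ge_0[of x] by linarith
  then show ?thesis using assms unfolding frac_similar_def by auto
qed

section \<open>Regions\<close>

text \<open>With this sign a delay of \<open>t\<close> subtracts \<open>t\<close> from every point,
  and \<open>clock_frac\<close> becomes the ordinary \<open>frac\<close> for both kinds of
  clocks.\<close>

fun line_point :: "'a clock \<Rightarrow> real \<Rightarrow> real" where
  "line_point (Hist s) d = - d"
| "line_point (Proph s) d = d"

text \<open>The value at undefined clocks is junk.\<close>

definition pos :: "'a valuation \<Rightarrow> 'a clock \<Rightarrow> real" where
  "pos v x = (case v x of None \<Rightarrow> 0 | Some d \<Rightarrow> line_point x d)"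

lemma pos_Some: "v x = Some d \<Longrightarrow> pos v x = line_point x d"
  by (simp add: pos_def)

lemma clock_frac_line_point: "clock_frac x d = frac (line_point x d)"
  by (cases x) (simp_all add: frac_def ceiling_def)

text \<open>Floor and integrality together determine the ceiling, and reflection at \<open>0\<close>
  exchanges floor and ceiling up to sign. The second condition of \<open>region_equiv\<close> thus
  has one form for both kinds of clocks.\<close>

lemma floor_ceiling_line_point:
  "\<lceil>a\<rceil> = \<lceil>b\<rceil> \<and> \<lfloor>a\<rfloor> = \<lfloor>b\<rfloor> \<longleftrightarrow>
   \<lfloor>line_point x a\<rfloor> = \<lfloor>line_point x b\<rfloor> \<and>
   (frac (line_point x a) = 0 \<longleftrightarrow> frac (line_point x b) = 0)"
proof -
  have *: "\<lceil>a\<rceil> = (if frac a = 0 then \<lfloor>a\<rfloor> else \<lfloor>a\<rfloor> + 1)" for a :: real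
    by (simp add: ceiling_altdef frac_def)
  have **: "frac (- a) = 0 \<longleftrightarrow> frac a = 0" for a :: real by (simp add: frac_eq_0_iff)
  have "\<lfloor>- a\<rfloor> = - \<lceil>a\<rceil>" for a :: real by (simp add: ceiling_def)
  then show ?thesis by (cases x) (auto simp: * ** split: if_splits)
qed

section \<open>Passing between region equivalence and similar configurations\<close>

lemma
  assumes "region_equiv c v u"
  shows region_equiv_None: "v x = None \<longleftrightarrow> u x = None"
    and region_equiv_values: "v x = Some a \<Longrightarrow> u x = Some b \<Longrightarrow>
      (a > real c \<and> b > real c) \<or> (\<lceil>a\<rceil> = \<lceil>b\<rceil> \<and> \<lfloor>a\<rfloor> = \<lfloor>b\<rfloor>)"
    and region_equiv_frac: "v x = Some a \<Longrightarrow> v y = Some a' \<Longrightarrow> u x = Some b \<Longrightarrow> u y = Some b' \<Longrightarrow>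
      a \<le> real c \<Longrightarrow> a' \<le> real c \<Longrightarrow>
      clock_frac x a \<le> clock_frac y a' \<longleftrightarrow> clock_frac x b \<le> clock_frac y b'"
proof -
  have "\<forall>x. v x = None \<longleftrightarrow> u x = None"
    using assms unfolding region_equiv_def by (elim conjE)
  then show "v x = None \<longleftrightarrow> u x = None" ..
  have "\<forall>x a b. v x = Some a \<and> u x = Some b \<longrightarrow>
      (a > real c \<and> b > real c) \<or> (\<lceil>a\<rceil> = \<lceil>b\<rceil> \<and> \<lfloor>a\<rfloor> = \<lfloor>b\<rfloor>)"
    using assms unfolding region_equiv_def by (elim conjE)
  then show "v x = Some a \<Longrightarrow> u x = Some b \<Longrightarrow>
      (a > real c \<and> b > real c) \<or> (\<lceil>a\<rceil> = \<lceil>b\<rceil> \<and> \<lfloor>a\<rfloor> = \<lfloor>b\<rfloor>)"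
    by blast
  show "clock_frac x a \<le> clock_frac y a' \<longleftrightarrow> clock_frac x b \<le> clock_frac y b'"
    if "v x = Some a" "v y = Some a'" "u x = Some b" "u y = Some b'" "a \<le> real c" "a' \<le> real c"
    using assms that unfolding region_equiv_def by blast
qed

lemma region_equiv_Some:
  assumes "region_equiv c v u" "v x = Some a"
  obtains b where "u x = Some b"
  using region_equiv_None[OF assms(1), of x] assms(2) by auto

text \<open>A clock whose value in \<open>v\<close> is at most \<open>c\<close> cannot satisfy the
  alternative that both values exceed \<open>c\<close>, so integer parts and fractional order must
  match.\<close>

lemma region_equiv_frac_similar:
  assumes eq: "region_equiv c v u"
  shows "frac_similar {x. \<exists>d. v x = Some d \<and> d \<le> real c} (pos v) (pos u)"
proof -
  have ex: "\<exists>b. u x = Some b \<and> \<lceil>a\<rceil> = \<lceil>b\<rceil> \<and> \<lfloor>a\<rfloor> = \<lfloor>b\<rfloor>" if "v x = Some a" "a \<le> real c" for x a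
  proof -
    obtain b where b: "u x = Some b" using region_equiv_Some[OF eq] \<open>v x = Some a\<close> by blast
    then show ?thesis using region_equiv_values[OF eq that(1) b] that(2) by auto
  qed
  show ?thesis unfolding frac_similar_def
  proof (intro conjI ballI)
    fix x assume "x \<in> {x. \<exists>d. v x = Some d \<and> d \<le> real c}"
    then obtain a b where "v x = Some a" "u x = Some b" "\<lceil>a\<rceil> = \<lceil>b\<rceil> \<and> \<lfloor>a\<rfloor> = \<lfloor>b\<rfloor>"
      using ex by blast
    then show "\<lfloor>pos v x\<rfloor> = \<lfloor>pos u x\<rfloor>" "frac (pos v x) = 0 \<longleftrightarrow> frac (pos u x) = 0"
      unfolding floor_ceiling_line_point[of a b x] by (simp_all add: pos_Some)
  next
    fix x y
    assume "x \<in> {x. \<exists>d. v x = Some d \<and> d \<le> real c}" "y \<in> {x. \<exists>d. v x = Some d \<and> d \<le> real c}"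
    then obtain a b a' b' where "v x = Some a" "u x = Some b" "a \<le> real c"
      "v y = Some a'" "u y = Some b'" "a' \<le> real c" using ex by blast
    then show "frac (pos v x) \<le> frac (pos v y) \<longleftrightarrow> frac (pos u x) \<le> frac (pos u y)"
      using region_equiv_frac[OF eq] by (simp add: pos_Some flip: clock_frac_line_point)
  qed
qed

text \<open>The set \<open>S\<close> is left free: it may include clocks above \<open>c\<close>, for
  which similarity is more than a region demands.\<close>

lemma frac_similar_region_equiv:
  assumes none: "\<And>x. v x = None \<longleftrightarrow> u x = None"
    and big: "\<And>x a b. x \<notin> S \<Longrightarrow> v x = Some a \<Longrightarrow> u x = Some b \<Longrightarrow> a > real c \<and> b > real c"
    and sim: "frac_similar S (pos v) (pos u)"
  shows "region_equiv c v u"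
  unfolding region_equiv_def
proof (intro conjI allI impI)
  show "v x = None \<longleftrightarrow> u x = None" for x by (fact none)
next
  fix x a b assume *: "v x = Some a \<and> u x = Some b"
  show "(a > real c \<and> b > real c) \<or> (\<lceil>a\<rceil> = \<lceil>b\<rceil> \<and> \<lfloor>a\<rfloor> = \<lfloor>b\<rfloor>)"
  proof (cases "x \<in> S")
    case True
    then have "\<lfloor>pos v x\<rfloor> = \<lfloor>pos u x\<rfloor> \<and> (frac (pos v x) = 0 \<longleftrightarrow> frac (pos u x) = 0)"
      using sim unfolding frac_similar_def by blast
    then show ?thesis using * unfolding floor_ceiling_line_point[of a b x] by (simp add: pos_Some)
  next
    case False
    then show ?thesis using big * by blast
  qed
next
  fix x y a1 a2 b1 b2
  assume *: "v x = Some a1 \<and> v y = Some a2 \<and> u x = Some b1 \<and> u y = Some b2 \<and>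
    a1 \<le> real c \<and> a2 \<le> real c"
  then have "x \<in> S" "y \<in> S" using big by (meson not_le)+
  then have "frac (pos v x) \<le> frac (pos v y) \<longleftrightarrow> frac (pos u x) \<le> frac (pos u y)"
    using sim unfolding frac_similar_def by blast
  then show "clock_frac x a1 \<le> clock_frac y a2 \<longleftrightarrow> clock_frac x b1 \<le> clock_frac y b2"
    using * by (simp add: pos_Some clock_frac_line_point)
qed

text \<open>Since \<open>c\<close> is an integer, being at most \<open>c\<close> is decided by the
  ceiling.\<close>

lemma region_equiv_le_iff:
  assumes "region_equiv c v u" "v x = Some a" "u x = Some b"
  shows "a \<le> real c \<longleftrightarrow> b \<le> real c"
proof -
  have "(a > real c \<and> b > real c) \<or> (\<lceil>a\<rceil> = \<lceil>b\<rceil> \<and> \<lfloor>a\<rfloor> = \<lfloor>b\<rfloor>)"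
    using region_equiv_values assms by blast
  then show ?thesis
    using ceiling_le_iff[of a "int c"] ceiling_le_iff[of b "int c"] by auto
qed

section \<open>Region equivalence as an equivalence relation, and regions as its classes\<close>

lemma region_equiv_refl: "region_equiv c v v"
  unfolding region_equiv_def by auto

lemma region_equiv_sym:
  assumes eq: "region_equiv c v u"
  shows "region_equiv c u v"
  unfolding region_equiv_def
proof (intro conjI allI impI)
  show "u x = None \<longleftrightarrow> v x = None" for x using region_equiv_None[OF eq] by blast
next
  fix x a b assume "u x = Some a \<and> v x = Some b"
  then show "(a > real c \<and> b > real c) \<or> (\<lceil>a\<rceil> = \<lceil>b\<rceil> \<and> \<lfloor>a\<rfloor> = \<lfloor>b\<rfloor>)"
    using region_equiv_values[OF eq, of x b a] by auto
next
  fix x y a1 a2 b1 b2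
  assume *: "u x = Some a1 \<and> u y = Some a2 \<and> v x = Some b1 \<and> v y = Some b2 \<and>
    a1 \<le> real c \<and> a2 \<le> real c"
  \<comment> \<open>The third condition bounds only the values of its first valuation, so the bound
    has to be carried over to \<open>v\<close>.\<close>
  then have "b1 \<le> real c" "b2 \<le> real c" using region_equiv_le_iff[OF eq] by blast+
  with * show "clock_frac x a1 \<le> clock_frac y a2 \<longleftrightarrow> clock_frac x b1 \<le> clock_frac y b2"
    using region_equiv_frac[OF eq] by blast
qed

lemma region_equiv_trans:
  assumes vu: "region_equiv c v u" and uw: "region_equiv c u w"
  shows "region_equiv c v w"
  unfolding region_equiv_def
proof (intro conjI allI impI)
  show "v x = None \<longleftrightarrow> w x = None" for x
    using region_equiv_None[OF vu, of x] region_equiv_None[OF uw, of x] by simp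
next
  fix x a b assume *: "v x = Some a \<and> w x = Some b"
  then obtain d where d: "u x = Some d" using region_equiv_Some[OF vu] by blast
  then show "(a > real c \<and> b > real c) \<or> (\<lceil>a\<rceil> = \<lceil>b\<rceil> \<and> \<lfloor>a\<rfloor> = \<lfloor>b\<rfloor>)"
    using * region_equiv_values[OF vu, of x a d] region_equiv_values[OF uw, of x d b]
      region_equiv_le_iff[OF vu, of x a d] region_equiv_le_iff[OF uw, of x d b] by linarith
next
  fix x y a1 a2 b1 b2
  assume *: "v x = Some a1 \<and> v y = Some a2 \<and> w x = Some b1 \<and> w y = Some b2 \<and>
    a1 \<le> real c \<and> a2 \<le> real c"
  then obtain d1 d2 where d: "u x = Some d1" "u y = Some d2"
    using region_equiv_Some[OF vu] by metis
  then have "d1 \<le> real c" "d2 \<le> real c" using region_equiv_le_iff[OF vu] * by blast+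
  with * d show "clock_frac x a1 \<le> clock_frac y a2 \<longleftrightarrow> clock_frac x b1 \<le> clock_frac y b2"
    using region_equiv_frac[OF vu, of x a1 y a2 d1 d2] region_equiv_frac[OF uw, of x d1 y d2 b1 b2]
    by simp
qed

lemma Reg_equiv:
  assumes "r \<in> Reg c" "v \<in> r" "u \<in> r"
  shows "v \<in> valuations" "region_equiv c v u"
proof -
  obtain w where "r = {(v1, v2). v1 \<in> valuations \<and> v2 \<in> valuations \<and> region_equiv c v1 v2} `` {w}"
    using assms(1) unfolding Reg_def by (rule quotientE)
  then have "v \<in> valuations" "region_equiv c w v" "region_equiv c w u" using assms by auto
  then show "v \<in> valuations" "region_equiv c v u"
    using region_equiv_sym region_equiv_trans by blast+
qed

lemma Reg_closed:
  assumes "r \<in> Reg c" "v \<in> r" "region_equiv c v u" "u \<in> valuations"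
  shows "u \<in> r"
proof -
  obtain w where "r = {(v1, v2). v1 \<in> valuations \<and> v2 \<in> valuations \<and> region_equiv c v1 v2} `` {w}"
    using assms(1) unfolding Reg_def by (rule quotientE)
  then show ?thesis using assms(2-4) region_equiv_trans by blast
qed

lemma Reg_nonempty:
  assumes "r \<in> Reg c"
  shows "\<exists>v. v \<in> r"
proof -
  obtain w where "w \<in> valuations"
    "r = {(v1, v2). v1 \<in> valuations \<and> v2 \<in> valuations \<and> region_equiv c v1 v2} `` {w}"
    using assms unfolding Reg_def by (rule quotientE)
  then have "w \<in> r" using region_equiv_refl by auto
  then show ?thesis by blast
qed

section \<open>Resets and guards under region equivalence\<close>

lemma region_equiv_reset_Hist:
  assumes eq: "region_equiv c v u"
  shows "region_equiv c (v(Hist s := Some 0)) (u(Hist s := Some 0))"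
proof -
  let ?v = "v(Hist s := Some 0)" and ?u = "u(Hist s := Some 0)"
  let ?S = "{x. \<exists>d. v x = Some d \<and> d \<le> real c}"
  \<comment> \<open>The old value of \<open>Hist s\<close> may be undefined or above
    \<open>c\<close>; the clock is therefore taken out of the configuration and put back at
    \<open>0\<close>.\<close>
  have sim: "frac_similar (?S - {Hist s}) (pos ?v) (pos ?u)"
    using frac_similar_mono[OF region_equiv_frac_similar[OF eq], of "?S - {Hist s}"]
    by (rule frac_similar_cong[THEN iffD1, rotated -1]) (auto simp: pos_def)
  have zero: "pos ?v (Hist s) = 0" "pos ?u (Hist s) = 0" by (simp_all add: pos_def)
  show ?thesis
  proof (rule frac_similar_region_equiv[OF _ _ frac_similar_insert_zero[where k = "Hist s", OF sim zero]])
    fix x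
    show "?v x = None \<longleftrightarrow> ?u x = None" using region_equiv_None[OF eq, of x] by simp
  next
    fix x a b assume "x \<notin> insert (Hist s) (?S - {Hist s})" "?v x = Some a" "?u x = Some b"
    then have *: "x \<noteq> Hist s" "v x = Some a" "u x = Some b" by (auto split: if_splits)
    with \<open>x \<notin> insert (Hist s) (?S - {Hist s})\<close> have "\<not> a \<le> real c" by blast
    then show "a > real c \<and> b > real c" using region_equiv_le_iff[OF eq *(2,3)] by simp
  qed
qed

lemma compares_region:
  fixes a b :: real
  assumes "(a > real c \<and> b > real c) \<or> (\<lceil>a\<rceil> = \<lceil>b\<rceil> \<and> \<lfloor>a\<rfloor> = \<lfloor>b\<rfloor>)" "n \<le> c"
  shows "compares p a (real n) \<longleftrightarrow> compares p b (real n)"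
proof -
  \<comment> \<open>Floor and ceiling decide the comparison with an integer; in the other case both
    values exceed \<open>c\<close> and hence \<open>n\<close>.\<close>
  have "a < real n \<longleftrightarrow> b < real n" "real n < a \<longleftrightarrow> real n < b"
    using assms floor_less_iff[of a "int n"] floor_less_iff[of b "int n"]
      less_ceiling_iff[of "int n" a] less_ceiling_iff[of "int n" b] by auto
  then show ?thesis by (cases p) (auto simp: order_eq_iff not_less[symmetric])
qed

lemma sat_region_equiv:
  assumes "region_equiv c v u" "\<forall>n\<in>guard_constants g. n \<le> c"
  shows "sat v g \<longleftrightarrow> sat u g"
  using assms(2)
proof (induction g)
  case (Atom x p n)
  show ?case
  proof (cases "v x")
    case None
    then have "u x = None" using region_equiv_None[OF assms(1)] by blast
    with None show ?thesis by simp
  next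
    case (Some a)
    then obtain b where b: "u x = Some b" using region_equiv_Some[OF assms(1)] by blast
    then show ?thesis
      using compares_region[OF region_equiv_values[OF assms(1) Some b], of n p] Atom Some by simp
  qed
qed auto

lemma guard_constants_le_cmax:
  assumes "wf_eca A"
  shows "\<forall>(q, s, g, q')\<in>transitions A. \<forall>n\<in>guard_constants g. n \<le> cmax A"
proof -
  have "finite (guard_constants g)" for g :: "'b guard" by (induction g) auto
  then have "finite (\<Union>(q, s, g, q') \<in> transitions A. guard_constants g)"
    using assms unfolding wf_eca_def by auto
  then show ?thesis unfolding cmax_def by (auto intro!: Max_ge)
qed

section \<open>Realising steps and paths\<close>

text \<open>Only prophecy clocks may move: a change of their values after a step can be absorbed by
  changing them before it, whereas history values after a step are dictated by those before.\<close>

definition far_variant :: "nat \<Rightarrow> 'a valuation \<Rightarrow> 'a valuation \<Rightarrow> bool" where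
  "far_variant c u u' \<longleftrightarrow>
     (\<forall>s. u' (Hist s) = u (Hist s)) \<and>
     (\<forall>s. u' (Proph s) = u (Proph s) \<or>
        (\<exists>a b. u (Proph s) = Some a \<and> u' (Proph s) = Some b \<and> a > real c \<and> b > real c))"

lemma far_variant_refl: "far_variant c u u"
  unfolding far_variant_def by blast

lemma far_variant_trans:
  "far_variant c u v \<Longrightarrow> far_variant c v w \<Longrightarrow> far_variant c u w"
  unfolding far_variant_def by (metis option.inject)

text \<open>On the clocks where both valuations agree similarity is trivial; all others are prophecy
  clocks above \<open>c\<close> on both sides.\<close>

lemma far_variant_region_equiv:
  assumes "far_variant c u u'"
  shows "region_equiv c u u'"
proof (rule frac_similar_region_equiv[of _ _ "{x. u x = u' x}"])
  show "u x = None \<longleftrightarrow> u' x = None" for x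
    using assms unfolding far_variant_def by (cases x) (metis option.distinct(1))+
  fix x a b assume x: "x \<notin> {x. u x = u' x}" "u x = Some a" "u' x = Some b"
  then obtain s where "x = Proph s" using assms unfolding far_variant_def by (cases x) auto
  moreover have "u' (Proph s) = u (Proph s) \<or> (\<exists>a b. u (Proph s) = Some a \<and>
      u' (Proph s) = Some b \<and> a > real c \<and> b > real c)"
    using assms unfolding far_variant_def by blast
  ultimately show "a > real c \<and> b > real c" using x by auto
next
  show "frac_similar {x. u x = u' x} (pos u) (pos u')"
    unfolding frac_similar_def by (simp add: pos_def)
qed

lemma far_variant_valuations:
  assumes "far_variant c u u'" "u \<in> valuations"
  shows "u' \<in> valuations"
  unfolding valuations_def
proof (intro CollectI allI impI)
  fix x d assume d: "u' x = Some d"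
  have "u x = Some d \<or> d > real c"
    using assms(1) d unfolding far_variant_def by (cases x) (metis option.inject)+
  then show "d \<ge> 0"
    using assms(2) unfolding valuations_def by auto
qed

text \<open>The changed prophecy values are carried back through the same delay. A clock above
  \<open>c\<close> after the step was above \<open>c\<close> before it, as the delay is nonnegative.
  The intermediate valuations are far variants as well, so the guard still holds.\<close>

lemma step_far_variant:
  assumes st: "step A (q, u1) t a (q', u2)" and far: "far_variant c u2 u2'"
    and val: "u2' \<in> valuations"
    and bound: "\<forall>(q, s, g, q')\<in>transitions A. \<forall>n\<in>guard_constants g. n \<le> c"
  shows "\<exists>u1'. far_variant c u1 u1' \<and> step A (q, u1') t a (q', u2')"
proof -
  obtain g u where tr: "(q, a, g, q') \<in> transitions A" and u: "u \<in> valuations"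
    and u1: "u(Proph a := Some 0) = delay u1 t" and u2: "u(Hist a := Some 0) = u2"
    and sat: "sat u g" and val1: "u1 \<in> valuations" and can: "can_delay u1 t"
    using st unfolding step_def by auto
  have t: "t \<ge> 0" using can unfolding can_delay_def by blast
  define u' where "u' = (\<lambda>x. case x of Hist s \<Rightarrow> u x | Proph s \<Rightarrow> u2' x)"
  \<comment> \<open>The clock \<open>Proph a\<close> has to reach \<open>0\<close> after the delay,
    so it starts at \<open>t\<close> whatever value it is given after the event.\<close>
  define u1' where "u1' = (\<lambda>x. case x of Hist s \<Rightarrow> u1 x
    | Proph s \<Rightarrow> if s = a then Some t else map_option (\<lambda>d. d + t) (u2' x))"
  have u1a: "u1 (Proph a) = Some t"
    using fun_cong[OF u1, of "Proph a", symmetric] by (auto simp: delay_def split: option.splits)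
  have u1s: "u1 (Proph s) = map_option (\<lambda>d. d + t) (u2 (Proph s))" if "s \<noteq> a" for s
    using fun_cong[OF u1, of "Proph s"] that
    by (cases "u1 (Proph s)") (auto simp: delay_def u2[symmetric])
  have far_u: "far_variant c u u'"
    using far unfolding far_variant_def by (auto simp: u'_def u2[symmetric])
  have far1: "far_variant c u1 u1'"
    unfolding far_variant_def
  proof (intro conjI allI)
    fix s
    show "u1' (Hist s) = u1 (Hist s)" by (simp add: u1'_def)
    consider "u2' (Proph s) = u2 (Proph s)"
      | a b where "u2 (Proph s) = Some a" "u2' (Proph s) = Some b" "a > real c" "b > real c"
      using far unfolding far_variant_def by blast
    then show "u1' (Proph s) = u1 (Proph s) \<or> (\<exists>a b. u1 (Proph s) = Some a \<and>
        u1' (Proph s) = Some b \<and> a > real c \<and> b > real c)"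
      using t by cases (auto simp: u1'_def u1a u1s)
  qed
  have val': "u' \<in> valuations" "u1' \<in> valuations"
    using u val val1 t unfolding valuations_def u'_def u1'_def
    by (auto split: clock.splits if_splits)
  have can': "can_delay u1' t"
    using t val unfolding can_delay_def valuations_def u1'_def by (auto split: if_splits)
  have "u'(Proph a := Some 0) = delay u1' t"
  proof
    fix x
    show "(u'(Proph a := Some 0)) x = delay u1' t x"
      using fun_cong[OF u1, of x]
      by (cases x) (auto simp: u'_def u1'_def delay_def option.map_comp o_def option.map_ident)
  qed
  moreover have "u'(Hist a := Some 0) = u2'"
  proof
    fix x
    show "(u'(Hist a := Some 0)) x = u2' x"
      using far unfolding far_variant_def by (cases x) (auto simp: u'_def u2[symmetric])
  qed
  moreover have "sat u' g"
    using sat_region_equiv[OF far_variant_region_equiv[OF far_u]] bound tr sat by blast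
  ultimately have "step A (q, u1') t a (q', u2')"
    unfolding step_def using tr val' can' val by auto
  with far1 show ?thesis by blast
qed

text \<open>Two extensions are made: one places the prophecy clocks above \<open>c\<close> before
  the delay and thereby fixes the new delay, the other places the renewed prediction of
  \<open>Proph a\<close> after the event. Between them lies a translation.\<close>

lemma step_region:
  fixes A :: "('q, 'a::finite) eca"
  assumes eq: "region_equiv c v1 u1" and valu: "u1 \<in> valuations"
    and st: "step A (q, v1) t a (q', v2)"
    and bound: "\<forall>(q, s, g, q')\<in>transitions A. \<forall>n\<in>guard_constants g. n \<le> c"
  shows "\<exists>u1' t' u2. far_variant c u1 u1' \<and> step A (q, u1') t' a (q', u2) \<and> region_equiv c v2 u2"
proof -
  \<comment> \<open>Clocks inject into two copies of the finite alphabet, so all index sets below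
    are finite.\<close>
  have "\<exists>h::'a clock \<Rightarrow> 'a + 'a. inj h"
    by (intro exI[of _ "\<lambda>x. case x of Hist s \<Rightarrow> Inl s | Proph s \<Rightarrow> Inr s"])
      (auto simp: inj_def split: clock.splits)
  then have finU: "finite (UNIV :: 'a clock set)" using finite_imageD finite by blast
  then have fin: "finite X" for X :: "'a clock set" by (rule finite_subset[rotated]) simp
  obtain g v where tr: "(q, a, g, q') \<in> transitions A" and v: "v \<in> valuations"
    and v1: "v(Proph a := Some 0) = delay v1 t" and v2: "v(Hist a := Some 0) = v2"
    and sat: "sat v g" and val1: "v1 \<in> valuations" and can: "can_delay v1 t"
    using st unfolding step_def by auto
  have t: "t \<ge> 0" using can unfolding can_delay_def by blast
  have none: "v1 x = None \<longleftrightarrow> u1 x = None" for x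
    using region_equiv_None[OF eq] .
  have v1a: "v1 (Proph a) = Some t"
    using fun_cong[OF v1, of "Proph a", symmetric] by (auto simp: delay_def split: option.splits)
  have vP: "v (Proph s) = map_option (\<lambda>d. d - t) (v1 (Proph s))" if "s \<noteq> a" for s
    using fun_cong[OF v1, of "Proph s"] that by (simp add: delay_def)
  have vH: "v (Hist s) = map_option (\<lambda>d. d + t) (v1 (Hist s))" for s
    using fun_cong[OF v1, of "Hist s"] by (simp add: delay_def)

  define S0 where "S0 = {x. \<exists>d. v1 x = Some d \<and> d \<le> real c}"
  \<comment> \<open>A prophecy clock above \<open>c\<close> may fall to \<open>c\<close> or below
    during the delay, so its position must be matched too. History clocks above \<open>c\<close>
    stay above and can be left out.\<close>
  define S1 where "S1 = S0 \<union> {Proph s | s. v1 (Proph s) \<noteq> None}"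
  obtain e where e: "frac_similar S1 (pos v1) e" and e0: "\<And>x. x \<in> S0 \<Longrightarrow> e x = pos u1 x"
    using frac_similar_extend[OF fin fin region_equiv_frac_similar[OF eq]]
    unfolding S1_def S0_def by blast
  \<comment> \<open>In \<open>v1\<close> the clock \<open>Proph a\<close> equals the delay
    \<open>t\<close>, so its matching point in \<open>e\<close> is the new delay and translation by
    a point of the configuration applies.\<close>
  define t' where "t' = e (Proph a)"
  have aS1: "Proph a \<in> S1" using v1a by (simp add: S1_def)
  have tr1: "frac_similar S1 (\<lambda>x. pos v1 x - t) (\<lambda>x. e x - t')"
    using frac_similar_translate[OF e aS1] v1a by (simp add: pos_Some t'_def)
  have pv: "pos v x = pos v1 x - t" if "x \<in> S1 - {Proph a}" for x
    using that by (cases x) (auto simp: S1_def S0_def pos_def vP vH)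
  have "frac_similar (S1 - {Proph a}) (pos v) (\<lambda>x. e x - t')"
    using frac_similar_mono[OF tr1, of "S1 - {Proph a}"]
    by (rule frac_similar_cong[THEN iffD1, rotated -1]) (auto simp: pv)
  \<comment> \<open>The event discards the old prediction of \<open>Proph a\<close>; if
    \<open>v\<close> defines a new one, it enters as a fresh point.\<close>
  from frac_similar_extend[OF fin fin this]
  obtain E where E: "frac_similar (S1 - {Proph a} \<union> {x. x = Proph a \<and> v x \<noteq> None}) (pos v) E"
    and E1: "\<And>x. x \<in> S1 - {Proph a} \<Longrightarrow> E x = e x - t'" by blast
  define S2 where "S2 = S1 - {Proph a} \<union> {x. x = Proph a \<and> v x \<noteq> None}"

  define u1' where "u1' = (\<lambda>x. case x of Hist s \<Rightarrow> u1 x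
    | Proph s \<Rightarrow> if v1 x = None then None else Some (e x))"
  define u where "u = (\<lambda>x. case x of Hist s \<Rightarrow> map_option (\<lambda>d. d + t') (u1 x)
    | Proph s \<Rightarrow> if v x = None then None else Some (E x))"
  \<comment> \<open>The sign is visible in the floor, so similarity transfers nonnegativity of
    values and admissibility of the delay.\<close>
  have nonneg: "y \<ge> 0" if "\<lfloor>x\<rfloor> = \<lfloor>y\<rfloor>" "x \<ge> 0" for x y :: real
    using that by (metis zero_le_floor)
  have ge: "e (Proph s) \<ge> 0 \<and> e (Proph s) \<ge> t'" if "v1 (Proph s) = Some d" for s d
  proof -
    have "Proph s \<in> S1" using that by (simp add: S1_def)
    then have "\<lfloor>pos v1 (Proph s)\<rfloor> = \<lfloor>e (Proph s)\<rfloor>"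
      "\<lfloor>pos v1 (Proph s) - t\<rfloor> = \<lfloor>e (Proph s) - t'\<rfloor>"
      using e tr1 unfolding frac_similar_def by blast+
    moreover have "d \<ge> 0" "d - t \<ge> 0"
      using that val1 can unfolding valuations_def can_delay_def by auto
    moreover have "pos v1 (Proph s) = d" using that by (simp add: pos_Some)
    ultimately show ?thesis using nonneg[of d "e (Proph s)"] nonneg[of "d - t" "e (Proph s) - t'"]
      by simp
  qed
  have t': "t' \<ge> 0" using ge[OF v1a] by (simp add: t'_def)
  have far: "far_variant c u1 u1'"
    unfolding far_variant_def
  proof (intro conjI allI)
    fix s
    show "u1' (Hist s) = u1 (Hist s)" by (simp add: u1'_def)
    show "u1' (Proph s) = u1 (Proph s) \<or> (\<exists>a b. u1 (Proph s) = Some a \<and>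
        u1' (Proph s) = Some b \<and> a > real c \<and> b > real c)"
    proof (cases "v1 (Proph s)")
      case None
      then show ?thesis using none[of "Proph s"] by (simp add: u1'_def)
    next
      case (Some d)
      then obtain b where b: "u1 (Proph s) = Some b" using none[of "Proph s"] by auto
      show ?thesis
      proof (cases "d \<le> real c")
        case True
        then have "e (Proph s) = b" using e0[of "Proph s"] Some b by (simp add: S0_def pos_Some)
        then show ?thesis using Some b by (simp add: u1'_def)
      next
        case False
        \<comment> \<open>Similarity also fixes the ceiling, which keeps the newly chosen value
          above the integer \<open>c\<close>.\<close>
        have "Proph s \<in> S1" using Some by (simp add: S1_def)
        then have "\<lfloor>d\<rfloor> = \<lfloor>e (Proph s)\<rfloor> \<and> (frac d = 0 \<longleftrightarrow> frac (e (Proph s)) = 0)"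
          using e Some unfolding frac_similar_def by (auto simp: pos_Some)
        then have "\<lceil>d\<rceil> = \<lceil>e (Proph s)\<rceil>"
          using floor_ceiling_line_point[of d "e (Proph s)" "Proph s"] by simp
        then have "e (Proph s) > real c"
          using False less_ceiling_iff[of "int c" d] less_ceiling_iff[of "int c" "e (Proph s)"] by auto
        then show ?thesis
          using Some b False region_equiv_le_iff[OF eq Some b] by (auto simp: u1'_def)
      qed
    qed
  qed
  have val_u1': "u1' \<in> valuations"
    using valu ge unfolding valuations_def u1'_def by (auto split: clock.splits if_splits)
  have can': "can_delay u1' t'"
    using t' ge unfolding can_delay_def u1'_def by (auto split: if_splits)
  have delay_u: "u(Proph a := Some 0) = delay u1' t'"
  proof
    fix x
    show "(u(Proph a := Some 0)) x = delay u1' t' x"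
    proof (cases x)
      case (Hist s)
      then show ?thesis by (simp add: u_def u1'_def delay_def)
    next
      case (Proph s)
      show ?thesis
      proof (cases "s = a")
        case True
        then show ?thesis using Proph v1a by (simp add: u1'_def delay_def t'_def)
      next
        case False
        then have "E (Proph s) = e (Proph s) - t'" if "v1 (Proph s) \<noteq> None"
          using E1[of "Proph s"] that by (auto simp: S1_def)
        then show ?thesis using Proph False vP[OF False]
          by (auto simp: u_def u1'_def delay_def)
      qed
    qed
  qed
  have pu: "E x = pos u x" if "x \<in> S2" for x
  proof (cases x)
    case (Hist s)
    then have x: "x \<in> S0" "x \<in> S1 - {Proph a}" using that by (auto simp: S2_def S1_def)
    then obtain b where "u1 x = Some b" using none[of x] by (auto simp: S0_def)
    then show ?thesis using e0[OF x(1)] E1[OF x(2)] Hist by (simp add: pos_Some u_def)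
  next
    case (Proph s)
    then have "v x \<noteq> None" using that vP by (cases "s = a") (auto simp: S2_def S1_def S0_def)
    then show ?thesis using Proph by (auto simp: u_def pos_def)
  qed
  have sim: "frac_similar S2 (pos v) (pos u)"
    using E unfolding S2_def[symmetric]
    by (rule frac_similar_cong[THEN iffD1, rotated -1]) (auto simp: pu)
  have eq_vu: "region_equiv c v u"
    using sim
  proof (rule frac_similar_region_equiv[rotated -1])
    show "v x = None \<longleftrightarrow> u x = None" for x
      using none[of x] by (cases x) (auto simp: u_def vH)
    fix x a' b assume x: "x \<notin> S2" and vx: "v x = Some a'" and ux: "u x = Some b"
    show "a' > real c \<and> b > real c"
    proof (cases x)
      \<comment> \<open>Such a history clock was above \<open>c\<close> before the delay in both
        valuations, and it only grows.\<close>
      case (Hist s)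
      then obtain d d' where d: "v1 x = Some d" "a' = d + t" "u1 x = Some d'" "b = d' + t'"
        using vx ux by (auto simp: vH u_def)
      then have "\<not> d \<le> real c" using x Hist by (auto simp: S2_def S1_def S0_def)
      moreover from this have "\<not> d' \<le> real c" using region_equiv_le_iff[OF eq d(1,3)] by simp
      ultimately show ?thesis using t t' d by simp
    next
      case (Proph s)
      then have "x \<in> S2" using vx vP by (cases "s = a") (auto simp: S2_def S1_def)
      with x show ?thesis ..
    qed
  qed
  have val_u: "u \<in> valuations"
    unfolding valuations_def
  proof (intro CollectI allI impI)
    fix x d assume ux: "u x = Some d"
    show "d \<ge> 0"
    proof (cases x)
      case (Hist s)
      then show ?thesis using ux valu t' by (auto simp: u_def valuations_def)
    next
      case (Proph s)
      then obtain d' where d': "v x = Some d'" using ux by (auto simp: u_def split: if_splits)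
      then have "x \<in> S2" using Proph vP by (cases "s = a") (auto simp: S2_def S1_def)
      then have "\<lfloor>d'\<rfloor> = \<lfloor>d\<rfloor>"
        using sim Proph ux d' unfolding frac_similar_def by (auto simp: pos_Some)
      moreover have "d' \<ge> 0" using v d' by (auto simp: valuations_def)
      ultimately show ?thesis using nonneg by blast
    qed
  qed
  have "sat u g" using sat_region_equiv[OF eq_vu] bound tr sat by blast
  moreover have "u(Hist a := Some 0) \<in> valuations" using val_u by (auto simp: valuations_def)
  ultimately have "step A (q, u1') t' a (q', u(Hist a := Some 0))"
    unfolding step_def using tr val_u val_u1' can' delay_u by auto
  with far region_equiv_reset_Hist[OF eq_vu, of a] v2 show ?thesis by blast
qed

text \<open>The start \<open>u\<close> is arbitrary because the first step dictates the
  representative from which the rest must be realised. The rest starts only from a far variant of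
  it, and this correction is pulled back through the first step and composed with the earlier
  one.\<close>

lemma region_path_realisable:
  fixes A :: "('q, 'a::finite) eca"
  assumes "wf_eca A"
    and "\<forall>k<length w. (p k, w ! k, p (Suc k)) \<in> edges (RA_exists (Reg (cmax A)) A)"
    and "p (length w) \<in> accepting (RA_exists (Reg (cmax A)) A)"
    and "snd (p 0) \<in> Reg (cmax A)" and "u \<in> snd (p 0)"
  shows "\<exists>u' ts \<rho>. far_variant (cmax A) u u' \<and> \<rho> 0 = (fst (p 0), u') \<and> length ts = length w \<and>
    (\<forall>k<length w. step A (\<rho> k) (ts ! k) (w ! k) (\<rho> (Suc k))) \<and>
    fst (\<rho> (length w)) \<in> accept_locs A \<and> final_valuation (snd (\<rho> (length w)))"
  using assms(2-)
proof (induction w arbitrary: p u)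
  case Nil
  then have "fst (p 0) \<in> accept_locs A" "final_valuation u"
    by (auto simp: RA_exists_def final_region_def)
  then show ?case
    using far_variant_refl by (intro exI[of _ u] exI[of _ "[]"] exI[of _ "\<lambda>_. (fst (p 0), u)"]) auto
next
  case (Cons a w)
  let ?c = "cmax A"
  note bound = guard_constants_le_cmax[OF assms(1)]
  obtain q r q' r' where p: "p 0 = (q, r)" "p (Suc 0) = (q', r')" by fastforce
  have "((q, r), a, (q', r')) \<in> edges (RA_exists (Reg ?c) A)" using Cons.prems(1) p by force
  then obtain v1 v2 t where r': "r' \<in> Reg ?c" and v: "v1 \<in> r" "v2 \<in> r'"
    "step A (q, v1) t a (q', v2)"
    by (auto simp: RA_exists_def)
  have r: "r \<in> Reg ?c" "u \<in> r" using Cons.prems p by auto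
  obtain u1 s u2 where 1: "far_variant ?c u u1" "step A (q, u1) s a (q', u2)"
    "region_equiv ?c v2 u2"
    using step_region[OF Reg_equiv(2)[OF r(1) v(1) r(2)] Reg_equiv(1)[OF r(1,2,2)] v(3) bound] by blast
  have "u2 \<in> valuations" using 1(2) unfolding step_def by simp
  then have u2: "u2 \<in> r'" using Reg_closed[OF r' v(2) 1(3)] by blast
  have "\<exists>u' ts \<rho>. far_variant ?c u2 u' \<and> \<rho> 0 = (fst ((p \<circ> Suc) 0), u') \<and> length ts = length w \<and>
    (\<forall>k<length w. step A (\<rho> k) (ts ! k) (w ! k) (\<rho> (Suc k))) \<and>
    fst (\<rho> (length w)) \<in> accept_locs A \<and> final_valuation (snd (\<rho> (length w)))"
  proof (rule Cons.IH)
    show "\<forall>k<length w. ((p \<circ> Suc) k, w ! k, (p \<circ> Suc) (Suc k)) \<in> edges (RA_exists (Reg ?c) A)"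
      using Cons.prems(1) by fastforce
    show "(p \<circ> Suc) (length w) \<in> accepting (RA_exists (Reg ?c) A)" using Cons.prems(2) by simp
    show "snd ((p \<circ> Suc) 0) \<in> Reg ?c" "u2 \<in> snd ((p \<circ> Suc) 0)" using r' u2 p by simp_all
  qed
  then obtain u2' ts \<rho> where 2: "far_variant ?c u2 u2'" "\<rho> 0 = (q', u2')" "length ts = length w"
    "\<forall>k<length w. step A (\<rho> k) (ts ! k) (w ! k) (\<rho> (Suc k))"
    "fst (\<rho> (length w)) \<in> accept_locs A" "final_valuation (snd (\<rho> (length w)))"
    using p by auto
  \<comment> \<open>The remaining run starts at \<open>u2'\<close> instead of \<open>u2\<close>; the
    first step is repaired with the same delay \<open>s\<close>.\<close>
  have "u2' \<in> valuations" using far_variant_valuations[OF 2(1)] \<open>u2 \<in> valuations\<close> by blast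
  then obtain u1' where 3: "far_variant ?c u1 u1'" "step A (q, u1') s a (q', u2')"
    using step_far_variant[OF 1(2) 2(1) _ bound] by blast
  have "\<forall>k<length (a # w). step A (case_nat (q, u1') \<rho> k) ((s # ts) ! k) ((a # w) ! k)
      (case_nat (q, u1') \<rho> (Suc k))"
    using 3(2) 2(2,4) by (auto split: nat.split)
  then show ?case
    using far_variant_trans[OF 1(1) 3(1)] 2 p
    by (intro exI[of _ u1'] exI[of _ "s # ts"] exI[of _ "case_nat (q, u1') \<rho>"]) auto
qed

text \<open>Time stamps are partial sums of the delays. Each sum includes its own index, so the
  first stamp is the first delay.\<close>

lemma delays_timed_word:
  fixes ts :: "real list"
  assumes "\<And>k. k < length ts \<Longrightarrow> ts ! k \<ge> 0"
  shows "\<exists>\<tau>. length \<tau> = length ts \<and> sorted \<tau> \<and> (\<forall>t\<in>set \<tau>. t \<ge> 0) \<and>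
    (\<forall>k<length ts. (if k = 0 then \<tau> ! 0 else \<tau> ! k - \<tau> ! (k - 1)) = ts ! k)"
proof -
  define \<tau> where "\<tau> = map (\<lambda>k. \<Sum>i\<le>k. ts ! i) [0..<length ts]"
  have nth: "\<tau> ! k = (\<Sum>i\<le>k. ts ! i)" if "k < length ts" for k using that by (simp add: \<tau>_def)
  have len: "length \<tau> = length ts" by (simp add: \<tau>_def)
  have "sorted \<tau>"
    unfolding sorted_iff_nth_mono using len nth assms by (auto intro!: sum_mono2)
  moreover have "\<forall>t\<in>set \<tau>. t \<ge> 0" using assms by (auto simp: \<tau>_def intro!: sum_nonneg)
  moreover have "(if k = 0 then \<tau> ! 0 else \<tau> ! k - \<tau> ! (k - 1)) = ts ! k" if "k < length ts" for k
    using that by (cases k) (auto simp: nth)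
  ultimately show ?thesis using len by blast
qed

theorem theorem1:
  fixes A :: "('q, 'a::finite) eca"
  assumes "wf_eca A"
  shows "automaton_lang (RA_exists (Reg (cmax A)) A) \<subseteq> untime ` lang A"
proof
  fix w assume "w \<in> automaton_lang (RA_exists (Reg (cmax A)) A)"
  then obtain p where p: "p 0 \<in> initials (RA_exists (Reg (cmax A)) A)"
    "p (length w) \<in> accepting (RA_exists (Reg (cmax A)) A)"
    "\<forall>k<length w. (p k, w ! k, p (Suc k)) \<in> edges (RA_exists (Reg (cmax A)) A)"
    unfolding automaton_lang_def by blast
  obtain r where r: "p 0 = (start A, r)" "r \<in> Reg (cmax A)" "initial_region r"
    using p(1) by (auto simp: RA_exists_def)
  obtain u where u: "u \<in> r" using Reg_nonempty[OF r(2)] by blast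
  obtain u' ts \<rho> where run: "far_variant (cmax A) u u'" "\<rho> 0 = (start A, u')"
    "length ts = length w" "\<And>k. k < length w \<Longrightarrow> step A (\<rho> k) (ts ! k) (w ! k) (\<rho> (Suc k))"
    "fst (\<rho> (length w)) \<in> accept_locs A" "final_valuation (snd (\<rho> (length w)))"
    using region_path_realisable[OF assms p(3,2), of u] r u by auto
  have "ts ! k \<ge> 0" if "k < length ts" for k
    using run(4)[of k] that run(3) unfolding step_def can_delay_def by (auto split: prod.splits)
  then obtain \<tau> where \<tau>: "length \<tau> = length ts" "sorted \<tau>" "\<forall>t\<in>set \<tau>. t \<ge> 0"
    "\<forall>k<length ts. (if k = 0 then \<tau> ! 0 else \<tau> ! k - \<tau> ! (k - 1)) = ts ! k"
    using delays_timed_word by blast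
  have "initial_valuation u" using r(3) u unfolding initial_region_def by blast
  \<comment> \<open>Being initial concerns history clocks only, and these are unchanged in a far
    variant.\<close>
  then have init: "initial_valuation u'"
    using run(1) unfolding initial_valuation_def far_variant_def by simp
  have val: "u' \<in> valuations"
    using far_variant_valuations[OF run(1)] Reg_equiv(1)[OF r(2) u u] by blast
  have "accepting_run A (\<tau>, w) \<rho>"
    unfolding accepting_run_def using run \<tau> init val by simp
  moreover have "(\<tau>, w) \<in> timed_words" using \<tau> run(3) unfolding timed_words_def by simp
  ultimately have "(\<tau>, w) \<in> lang A" unfolding lang_def by blast
  then show "w \<in> untime ` lang A" unfolding untime_def by force
qed

end
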